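(* Let $d\ge 2$, let $\mathrm{k}\colon\mathbb{R}\times\mathbb{R}\to\mathbb{R}$ and $K\colon\mathbb{R}^d\times\mathbb{R}^d\to\mathbb{R}$ be related by $$K(x,y)=\mathbb{E}_{\xi\sim\mathcal{U}_{\mathbb{S}^{d-1}}}\big[\mathrm{k}(P_\xi(x),P_\xi(y))\big]\qquad\text{for all }x,y\in\mathbb{R}^d,$$ and let $x,y\in\mathbb{R}^d$. Assume that there exists $c_d(x,y)>0$ such that $|\mathrm{k}(z_1,z_2)|<c_d(x,y)$ for all $z_1,z_2\in\mathbb{R}$ with $|z_1|,|z_2|<\max(\|x\|,\|y\|)$. Let $P\ge 1$ and let $\xi_1,\dots,\xi_P\sim\mathcal{U}_{\mathbb{S}^{d-1}}$ be i.i.d. Then, for all $t>0$, $$\mathbb{P}\Big[\Big|\frac1P\sum_{p=1}^P\mathrm{k}(P_{\xi_p}(x),P_{\xi_p}(y))-K(x,y)\Big|>t\Big]\le 2\exp\Big(-\frac{P\,t^2}{2\,c_d(x,y)^2}\Big),$$ and $$\mathbb{E}\Big[\Big|\frac1P\sum_{p=1}^P\mathrm{k}(P_{\xi_p}(x),P_{\xi_p}(y))-K(x,y)\Big|\Big]\le\frac{\sqrt{2\pi}\,c_d(x,y)}{\sqrt{P}} .$$ In particular the latter expected error is in $O\big(c_d(x,y)/\sqrt{P}\big)$.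
   Context: $\|\cdot\|$ is the Euclidean norm, $\mathbb{S}^{d-1}$ the unit sphere in $\mathbb{R}^d$, $\mathcal{U}_{\mathbb{S}^{d-1}}$ the uniform probability distribution on it, and $P_\xi(x)=\langle\xi,x\rangle$ for $\xi\in\mathbb{S}^{d-1}$, $x\in\mathbb{R}^d$. The kernel $\mathrm{k}$ is measurable and such that the expectation defining $K$ exists. *)

theory Defs
  imports "HOL-Probability.Probability"
begin

text \<open>
  The uniform distribution on the unit sphere is the law of \<open>u / norm u\<close> for \<open>u\<close> uniform in the
  unit ball, i.e. the normalised surface (cone) measure. It is a Borel measure on the whole
  space. \<open>sgn 0 = 0\<close> lies off the sphere, but the point \<open>0\<close> has Lebesgue measure zero; the lemmas
  below confirm that this is a rotation-invariant probability measure carried by the sphere.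
\<close>

definition uniform_sphere :: "'a::euclidean_space measure" where
  "uniform_sphere = distr (uniform_measure lborel (ball 0 1)) borel sgn"

lemma borel_measurable_sgn_euclidean [measurable]:
  "(sgn :: 'a::euclidean_space \<Rightarrow> 'a) \<in> borel_measurable borel"
  unfolding sgn_div_norm by measurable

lemma sets_uniform_sphere [simp, measurable_cong]: "sets uniform_sphere = sets borel"
  by (simp add: uniform_sphere_def)

lemma space_uniform_sphere [simp]: "space uniform_sphere = UNIV"
  by (simp add: uniform_sphere_def)

lemma emeasure_lborel_unit_ball:
  "emeasure lborel (ball (0::'a::euclidean_space) 1) \<noteq> 0"
  "emeasure lborel (ball (0::'a::euclidean_space) 1) \<noteq> \<infinity>"
proof -
  show "emeasure lborel (ball (0::'a) 1) \<noteq> 0"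
    using open_not_negligible[of "ball (0::'a) 1"]
    by (auto simp: negligible_iff_null_sets null_sets_def)
  show "emeasure lborel (ball (0::'a) 1) \<noteq> \<infinity>"
    using emeasure_bounded_finite[OF bounded_ball, of "0::'a" 1] by simp
qed

lemma prob_space_uniform_sphere: "prob_space (uniform_sphere :: 'a::euclidean_space measure)"
  unfolding uniform_sphere_def
  by (intro prob_space.prob_space_distr prob_space_uniform_measure emeasure_lborel_unit_ball)
     (auto simp: measurable_cong_sets[OF sets_uniform_measure refl])

lemma AE_uniform_sphere: "AE \<xi> in uniform_sphere. \<xi> \<in> sphere (0::'a::euclidean_space) 1"
proof -
  have "AE u in lborel. u \<noteq> (0::'a)"
    by (rule AE_lborel_singleton)
  hence "AE u in lborel. u \<in> ball 0 1 \<longrightarrow> sgn u \<in> sphere (0::'a) 1"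
    by eventually_elim (simp add: norm_sgn)
  hence "AE u in uniform_measure lborel (ball 0 1). sgn u \<in> sphere (0::'a) 1"
    by (intro AE_uniform_measureI) auto
  thus ?thesis
    unfolding uniform_sphere_def
    by (subst AE_distr_iff) (auto simp: measurable_cong_sets[OF sets_uniform_measure refl])
qed

lemma emeasure_uniform_sphere:
  fixes A :: "'a::euclidean_space set"
  assumes A: "A \<in> sets borel"
  shows "emeasure uniform_sphere A =
    emeasure lborel (ball 0 1 \<inter> sgn -` A) / emeasure lborel (ball (0::'a) 1)"
proof -
  have "sgn -` A \<in> sets borel"
    using measurable_sets[OF borel_measurable_sgn_euclidean A] by simp
  thus ?thesis
    unfolding uniform_sphere_def using A
    by (subst emeasure_distr)
       (auto simp: measurable_cong_sets[OF sets_uniform_measure refl])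
qed

lemma distr_uniform_sphere_orthogonal:
  fixes f :: "real^'n::{finite,wellorder} \<Rightarrow> real^'n::_"
  assumes f: "orthogonal_transformation f"
  shows "distr uniform_sphere borel f = uniform_sphere"
proof (rule measure_eqI)
  fix A :: "(real^'n::_) set"
  assume "A \<in> sets (distr uniform_sphere borel f)"
  hence A [measurable]: "A \<in> sets borel" by simp
  have lin: "linear f" using f by (rule orthogonal_transformation_linear)
  have meas [measurable]: "f \<in> borel_measurable borel"
    using lin by (intro borel_measurable_continuous_onI linear_continuous_on)
                 (simp add: linear_conv_bounded_linear)
  define B where "B = ball 0 1 \<inter> sgn -` A"
  have meas_vimage: "ball 0 1 \<inter> sgn -` X \<in> lmeasurable" "ball 0 1 \<inter> sgn -` X \<in> sets borel"
    if [measurable]: "X \<in> sets borel" for X :: "(real^'n::_) set"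
  proof -
    have "ball 0 1 \<inter> sgn -` X = {u \<in> space borel. u \<in> ball 0 1 \<and> sgn u \<in> X}" by auto
    thus b: "ball 0 1 \<inter> sgn -` X \<in> sets borel" by simp
    show "ball 0 1 \<inter> sgn -` X \<in> lmeasurable"
      by (rule fmeasurableI2[OF lmeasurable_ball[of 0 1]]) (use b in auto)
  qed
  have fA: "f -` A \<in> sets borel"
    using measurable_sets[OF meas A] by simp
  have "ball 0 1 \<inter> sgn -` (f -` A) = f -` B"
    using lin by (auto simp: B_def sgn_div_norm linear_cmul orthogonal_transformation_norm[OF f])
  hence "f ` (ball 0 1 \<inter> sgn -` (f -` A)) = B"
    using orthogonal_transformation_surj[OF f] by (simp add: surj_image_vimage_eq)
  hence "measure lebesgue B = measure lebesgue (ball 0 1 \<inter> sgn -` (f -` A))"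
    using measure_orthogonal_image[OF f meas_vimage(1)[OF fA]] by simp
  hence "emeasure lebesgue B = emeasure lebesgue (ball 0 1 \<inter> sgn -` (f -` A))"
    using meas_vimage(1)[OF fA] meas_vimage(1)[OF A]
    by (simp add: emeasure_eq_measure2 B_def)
  hence "emeasure lborel B = emeasure lborel (ball 0 1 \<inter> sgn -` (f -` A))"
    using meas_vimage(2)[OF fA] meas_vimage(2)[OF A] by (simp add: B_def)
  thus "emeasure (distr uniform_sphere borel f) A = emeasure uniform_sphere A"
    using fA A by (simp add: emeasure_distr emeasure_uniform_sphere B_def
                      measurable_cong_sets[OF sets_uniform_sphere refl])
qed simp

text \<open>
  \<open>\<xi> 1, \<dots>, \<xi> P\<close> are i.i.d. with the uniform distribution on the sphere. The values are vectors of
  the ambient space, so they lie on the sphere almost surely.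
\<close>

definition iid_uniform_sphere ::
    "'w measure \<Rightarrow> nat \<Rightarrow> (nat \<Rightarrow> 'w \<Rightarrow> 'a::euclidean_space) \<Rightarrow> bool" where
  "iid_uniform_sphere M P \<xi> \<longleftrightarrow>
     prob_space M \<and>
     prob_space.indep_vars M (\<lambda>_. borel) \<xi> {1..P} \<and>
     (\<forall>p\<in>{1..P}. distr M borel (\<xi> p) = uniform_sphere)"

definition proj :: "'a::euclidean_space \<Rightarrow> 'a \<Rightarrow> real" where
  "proj \<xi> x = \<xi> \<bullet> x"

definition slicing_error ::
    "(real \<Rightarrow> real \<Rightarrow> real) \<Rightarrow> ('a::euclidean_space \<Rightarrow> 'a \<Rightarrow> real) \<Rightarrow> nat \<Rightarrow> (nat \<Rightarrow> 'a) \<Rightarrow> 'a \<Rightarrow> 'a \<Rightarrow> real"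
  where
  "slicing_error k K P \<xi> x y =
     \<bar>1 / real P * (\<Sum>p=1..P. k (proj (\<xi> p) x) (proj (\<xi> p) y)) - K x y\<bar>"

end

theory Submission
  imports Defs
begin

text \<open>
  In dimension at least two, every line through the origin is a null set, so \<open>\<bar>\<xi> \<bullet> x\<bar> < norm x\<close> holds
  almost surely for \<open>x \<noteq> 0\<close>. Hence, unless \<open>x = y = 0\<close> (where the error vanishes identically), the
  strict bound on the open square already bounds the summands almost surely by \<open>c\<close>, and
  the tail estimate is Hoeffding's inequality. The mean error is at most the standard deviation
  of the empirical mean, which is at most \<open>c / sqrt P\<close> by independence; this is better than the
  constant \<open>sqrt (2 * pi)\<close> that one gets by integrating the tail.
\<close>

section \<open>Almost sure strict bounds on projections of the sphere\<close>

text \<open>Equality in Cauchy-Schwarz would put the direction on the line spanned by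
  \<open>x\<close>. Since \<open>uniform_sphere\<close> is the image of the uniform law on the ball
  under \<open>sgn\<close>, it suffices that Lebesgue-almost every \<open>u\<close> avoids this
  line, which has dimension 1 < \<open>DIM('a)\<close>.\<close>

lemma AE_uniform_sphere_abs_inner_less:
  fixes x :: "'a::euclidean_space"
  assumes dim: "DIM('a) \<ge> 2" and x: "x \<noteq> 0"
  shows "AE \<zeta> in uniform_sphere. \<bar>\<zeta> \<bullet> x\<bar> < norm x"
proof -
  have "dim (span {x}) < DIM('a)"
    using dim x by (simp add: dim_singleton)
  hence "negligible (span {x})"
    by (rule negligible_lowdim)
  hence "AE u in lebesgue. u \<notin> span {x}"
    by (simp add: negligible_iff_null_sets AE_not_in)
  hence "AE u in lborel. u \<notin> span {x}"
    by (subst (asm) AE_completion_iff) auto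
  hence "AE u in lborel. u \<in> ball 0 1 \<longrightarrow> \<bar>sgn u \<bullet> x\<bar> < norm x"
  proof eventually_elim
    case (elim u)
    have u: "u \<noteq> 0"
      using elim span_zero by metis
    have "\<bar>u \<bullet> x\<bar> \<noteq> norm u * norm x"
    proof
      assume "\<bar>u \<bullet> x\<bar> = norm u * norm x"
      \<comment> \<open>Equality in Cauchy-Schwarz means collinearity with the origin; as
        \<open>x\<close> is nonzero, \<open>u\<close> is then a multiple of it.\<close>
      hence "collinear {0, x, u}"
        by (simp add: norm_cauchy_schwarz_equal insert_commute)
      hence "u \<in> span {x}"
        using x u by (auto simp: collinear_lemma span_breakdown_eq)
      with elim show False by simp
    qed
    hence "\<bar>u \<bullet> x\<bar> < norm u * norm x"
      using Cauchy_Schwarz_ineq2[of u x] by simp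
    thus ?case
      using u by (simp add: sgn_div_norm abs_mult field_simps)
  qed
  hence "AE u in uniform_measure lborel (ball 0 1). \<bar>sgn u \<bullet> x\<bar> < norm x"
    by (intro AE_uniform_measureI) auto
  thus ?thesis
    unfolding uniform_sphere_def
    by (subst AE_distr_iff) (auto simp: measurable_cong_sets[OF sets_uniform_measure refl])
qed

text \<open>A nonzero vector has almost surely a projection strictly below its own norm. If one
  vector is zero, its projection is 0, which is strictly below the maximum because the other vector
  is nonzero.\<close>

lemma AE_uniform_sphere_proj_less_max:
  fixes x y :: "'a::euclidean_space"
  assumes dim: "DIM('a) \<ge> 2" and xy: "x \<noteq> 0 \<or> y \<noteq> 0"
  shows "AE \<zeta> in uniform_sphere. \<bar>proj \<zeta> x\<bar> < max (norm x) (norm y) \<and>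
           \<bar>proj \<zeta> y\<bar> < max (norm x) (norm y)"
proof -
  have *: "AE \<zeta> in uniform_sphere. \<bar>proj \<zeta> z\<bar> < max (norm x) (norm y)"
    if "norm z \<le> max (norm x) (norm y)" for z :: 'a
  proof (cases "z = 0")
    case True
    thus ?thesis using xy by (auto simp: proj_def less_max_iff_disj)
  next
    case False
    show ?thesis
      using AE_uniform_sphere_abs_inner_less[OF dim False] that
      by (auto simp: proj_def elim: eventually_mono)
  qed
  show ?thesis
    using *[of x] *[of y] by (auto simp: AE_conj_iff)
qed

section \<open>Tail and mean error of an empirical mean of bounded independent variables\<close>

text \<open>This is nonnegativity of the variance of \<open>\<bar>X\<bar>\<close>.\<close>

lemma (in prob_space) expectation_abs_le_sqrt:
  fixes X :: "'a \<Rightarrow> real"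
  assumes "integrable M X" "integrable M (\<lambda>\<omega>. (X \<omega>)\<^sup>2)"
  shows "expectation (\<lambda>\<omega>. \<bar>X \<omega>\<bar>) \<le> sqrt (expectation (\<lambda>\<omega>. (X \<omega>)\<^sup>2))"
  using variance_eq[of "\<lambda>\<omega>. \<bar>X \<omega>\<bar>"] variance_positive[of "\<lambda>\<omega>. \<bar>X \<omega>\<bar>"] assms
  by (intro real_le_rsqrt) simp

text \<open>Expand the square into a double sum: by independence each off-diagonal term has
  expectation E[\<open>X i\<close>] E[\<open>X j\<close>] = 0, so only the diagonal
  survives.\<close>

lemma (in prob_space) expectation_sum_square_indep:
  fixes X :: "'b \<Rightarrow> 'a \<Rightarrow> real"
  assumes fin: "finite I" and indep: "indep_vars (\<lambda>_. borel) X I"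
    and int: "\<And>i. i \<in> I \<Longrightarrow> integrable M (X i)"
    and int2: "\<And>i. i \<in> I \<Longrightarrow> integrable M (\<lambda>\<omega>. (X i \<omega>)\<^sup>2)"
    and mean: "\<And>i. i \<in> I \<Longrightarrow> expectation (X i) = 0"
  shows "integrable M (\<lambda>\<omega>. (\<Sum>i\<in>I. X i \<omega>)\<^sup>2)"
    and "expectation (\<lambda>\<omega>. (\<Sum>i\<in>I. X i \<omega>)\<^sup>2) = (\<Sum>i\<in>I. expectation (\<lambda>\<omega>. (X i \<omega>)\<^sup>2))"
proof -
  have sq: "(\<lambda>\<omega>. (\<Sum>i\<in>I. X i \<omega>)\<^sup>2) = (\<lambda>\<omega>. \<Sum>i\<in>I. \<Sum>j\<in>I. X i \<omega> * X j \<omega>)"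
    by (simp add: power2_eq_square sum_product)
  have prod: "integrable M (\<lambda>\<omega>. X i \<omega> * X j \<omega>) \<and>
      expectation (\<lambda>\<omega>. X i \<omega> * X j \<omega>) = (if i = j then expectation (\<lambda>\<omega>. (X i \<omega>)\<^sup>2) else 0)"
    if ij: "i \<in> I" "j \<in> I" for i j
  proof (cases "i = j")
    case True
    thus ?thesis using int2[OF ij(1)] by (simp add: power2_eq_square)
  next
    case False
    \<comment> \<open>Restricting to the pair lets the product rules for finite independent families
      apply to \<open>X i * X j\<close>.\<close>
    have ind: "indep_vars (\<lambda>_. borel) X {i, j}"
      using indep by (rule indep_vars_subset) (use ij in auto)
    have "integrable M (\<lambda>\<omega>. \<Prod>l\<in>{i, j}. X l \<omega>)"
      by (rule indep_vars_integrable[OF _ ind]) (use ij int in auto)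
    moreover have "expectation (\<lambda>\<omega>. \<Prod>l\<in>{i, j}. X l \<omega>) = (\<Prod>l\<in>{i, j}. expectation (X l))"
      by (rule indep_vars_lebesgue_integral[OF _ ind]) (use ij int in auto)
    ultimately show ?thesis
      using False mean[OF ij(1)] by simp
  qed
  show "integrable M (\<lambda>\<omega>. (\<Sum>i\<in>I. X i \<omega>)\<^sup>2)"
    unfolding sq using prod by (intro Bochner_Integration.integrable_sum) auto
  show "expectation (\<lambda>\<omega>. (\<Sum>i\<in>I. X i \<omega>)\<^sup>2) = (\<Sum>i\<in>I. expectation (\<lambda>\<omega>. (X i \<omega>)\<^sup>2))"
    unfolding sq using prod fin
    by (subst Bochner_Integration.integral_sum, force intro: Bochner_Integration.integrable_sum)+
      (simp add: Bochner_Integration.integral_sum sum.delta)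
qed

text \<open>The tail is Hoeffding's inequality for values in [-c, c]. The mean error is bounded
  through the second moment of the centred sum, which is at most
  \<open>n * c\<^sup>2\<close>.\<close>

lemma (in prob_space) empirical_mean_error:
  fixes X :: "'b \<Rightarrow> 'a \<Rightarrow> real" and c \<mu> t :: real
  assumes fin: "finite I" and ne: "I \<noteq> {}" and c: "c > 0"
    and indep: "indep_vars (\<lambda>_. borel) X I"
    and bound: "\<And>i. i \<in> I \<Longrightarrow> AE \<omega> in M. \<bar>X i \<omega>\<bar> \<le> c"
    and mean: "\<And>i. i \<in> I \<Longrightarrow> expectation (X i) = \<mu>"
  defines "Z \<equiv> \<lambda>\<omega>. \<bar>(1 / real (card I)) * (\<Sum>i\<in>I. X i \<omega>) - \<mu>\<bar>"
  shows empirical_mean_error_tail: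
      "t > 0 \<Longrightarrow> prob {\<omega> \<in> space M. Z \<omega> > t} \<le> 2 * exp (- (card I * t\<^sup>2 / (2 * c\<^sup>2)))"
    and empirical_mean_error_expectation: "expectation Z \<le> c / sqrt (card I)"
proof -
  define n where "n = card I"
  have n: "n > 0" using fin ne by (auto simp: n_def card_gt_0_iff)
  have rv [measurable]: "X i \<in> borel_measurable M" if "i \<in> I" for i
    using indep that by (auto simp: indep_vars_def)
  \<comment> \<open>Both estimates concern the unnormalised sum, so the factor 1/n is pulled out of
    the absolute value.\<close>
  have Z: "Z = (\<lambda>\<omega>. \<bar>(\<Sum>i\<in>I. X i \<omega>) - n * \<mu>\<bar> / n)"
  proof
    fix \<omega>
    have "1 / real n * (\<Sum>i\<in>I. X i \<omega>) - \<mu> = ((\<Sum>i\<in>I. X i \<omega>) - n * \<mu>) / n"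
      using n by (simp add: field_simps)
    thus "Z \<omega> = \<bar>(\<Sum>i\<in>I. X i \<omega>) - n * \<mu>\<bar> / n" by (simp add: Z_def n_def)
  qed
  show "prob {\<omega> \<in> space M. Z \<omega> > t} \<le> 2 * exp (- (card I * t\<^sup>2 / (2 * c\<^sup>2)))" if t: "t > 0"
  proof -
    interpret H: Hoeffding_ineq M I X "\<lambda>_. -c" "\<lambda>_. c" "\<Sum>i\<in>I. expectation (X i)"
    proof unfold_locales
      show "AE \<omega> in M. X i \<omega> \<in> {-c..c}" if "i \<in> I" for i
        using bound[OF that] by eventually_elim auto
    qed (use fin indep in auto)
    have \<mu>: "(\<Sum>i\<in>I. expectation (X i)) = n * \<mu>"
      using mean by (simp add: n_def)
    \<comment> \<open>Hoeffding bounds a non-strict tail of the sum; the strict event for the mean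
      is contained in it at level \<open>n * t\<close>.\<close>
    have "{\<omega> \<in> space M. Z \<omega> > t} \<subseteq> {\<omega> \<in> space M. \<bar>(\<Sum>i\<in>I. X i \<omega>) - n * \<mu>\<bar> \<ge> n * t}"
      using n by (auto simp: Z field_simps)
    hence "prob {\<omega> \<in> space M. Z \<omega> > t}
        \<le> prob {\<omega> \<in> space M. \<bar>(\<Sum>i\<in>I. X i \<omega>) - n * \<mu>\<bar> \<ge> n * t}"
      by (rule finite_measure_mono) measurable
    also have "\<dots> \<le> 2 * exp (-2 * (n * t)\<^sup>2 / (\<Sum>i\<in>I. (c - - c)\<^sup>2))"
      using H.Hoeffding_ineq_abs_ge[of "n * t"] t n c unfolding \<mu> by (simp flip: n_def)
    \<comment> \<open>Each interval has length 2c, so the denominator is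
      \<open>4 * n * c\<^sup>2\<close> and one factor n cancels.\<close>
    also have "-2 * (n * t)\<^sup>2 / (\<Sum>i\<in>I. (c - - c)\<^sup>2) = - (card I * t\<^sup>2 / (2 * c\<^sup>2))"
      using n c by (simp add: n_def[symmetric] field_simps power2_eq_square)
    finally show ?thesis .
  qed
  have int: "integrable M (X i)" if "i \<in> I" for i
    by (rule integrable_const_bound[of _ c]) (use bound that in auto)
  have sq_le: "AE \<omega> in M. (X i \<omega>)\<^sup>2 \<le> c\<^sup>2" if "i \<in> I" for i
    using bound[OF that] by eventually_elim (use c in \<open>auto intro: abs_le_square_iff[THEN iffD1]\<close>)
  have int_sq: "integrable M (\<lambda>\<omega>. (X i \<omega>)\<^sup>2)" if "i \<in> I" for i
    by (rule integrable_const_bound[of _ "c\<^sup>2"]) (use sq_le that in auto)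
  \<comment> \<open>Centring makes the cross terms in the square of the sum vanish.\<close>
  define Y where "Y = (\<lambda>i \<omega>. X i \<omega> - \<mu>)"
  have indep_Y: "indep_vars (\<lambda>_. borel) Y I"
    unfolding Y_def by (rule indep_vars_compose2[OF indep]) auto
  have Y: "integrable M (Y i)" "integrable M (\<lambda>\<omega>. (Y i \<omega>)\<^sup>2)" "expectation (Y i) = 0"
    if "i \<in> I" for i
    using int[OF that] int_sq[OF that] mean[OF that]
    by (auto simp: Y_def power2_diff prob_space)
  \<comment> \<open>The variance is at most the second moment of \<open>X i\<close>, hence at most
    \<open>c\<^sup>2\<close>.\<close>
  have var: "expectation (\<lambda>\<omega>. (Y i \<omega>)\<^sup>2) \<le> c\<^sup>2" if "i \<in> I" for i
  proof -
    have "expectation (\<lambda>\<omega>. (Y i \<omega>)\<^sup>2) = expectation (\<lambda>\<omega>. (X i \<omega>)\<^sup>2) - \<mu>\<^sup>2"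
      using variance_eq[OF int[OF that] int_sq[OF that]] mean[OF that] by (simp add: Y_def)
    also have "\<dots> \<le> expectation (\<lambda>\<omega>. (X i \<omega>)\<^sup>2)" by simp
    also have "\<dots> \<le> expectation (\<lambda>\<omega>. c\<^sup>2)"
      by (rule integral_mono_AE) (use int_sq sq_le that in auto)
    finally show ?thesis by (simp add: prob_space)
  qed
  have sum_Y: "integrable M (\<lambda>\<omega>. (\<Sum>i\<in>I. Y i \<omega>)\<^sup>2)"
      "expectation (\<lambda>\<omega>. (\<Sum>i\<in>I. Y i \<omega>)\<^sup>2) = (\<Sum>i\<in>I. expectation (\<lambda>\<omega>. (Y i \<omega>)\<^sup>2))"
    proof -
    show "integrable M (\<lambda>\<omega>. (\<Sum>i\<in>I. Y i \<omega>)\<^sup>2)"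
      by (rule expectation_sum_square_indep(1)[OF fin indep_Y Y(1) Y(2) Y(3)])
    show "expectation (\<lambda>\<omega>. (\<Sum>i\<in>I. Y i \<omega>)\<^sup>2) = (\<Sum>i\<in>I. expectation (\<lambda>\<omega>. (Y i \<omega>)\<^sup>2))"
      by (rule expectation_sum_square_indep(2)[OF fin indep_Y Y(1) Y(2) Y(3)])
  qed
  have "expectation (\<lambda>\<omega>. \<bar>\<Sum>i\<in>I. Y i \<omega>\<bar>) \<le> sqrt (expectation (\<lambda>\<omega>. (\<Sum>i\<in>I. Y i \<omega>)\<^sup>2))"
    by (rule expectation_abs_le_sqrt) (use Y sum_Y(1) in auto)
  also have "\<dots> \<le> sqrt (n * c\<^sup>2)"
    unfolding sum_Y(2) n_def using var by (intro real_sqrt_le_mono sum_bounded_above) auto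
  also have "\<dots> = sqrt n * c"
    using c by (simp add: real_sqrt_mult)
  finally have "expectation (\<lambda>\<omega>. \<bar>\<Sum>i\<in>I. Y i \<omega>\<bar>) / n \<le> sqrt n * c / n"
    by (rule divide_right_mono) simp
  also have "\<dots> = c / sqrt n"
    using n by (simp add: field_simps)
  also have "expectation (\<lambda>\<omega>. \<bar>\<Sum>i\<in>I. Y i \<omega>\<bar>) / n = expectation Z"
    by (simp add: Z Y_def sum_subtractf n_def)
  finally show "expectation Z \<le> c / sqrt (card I)"
    by (simp add: n_def)
qed

section \<open>Application to the sliced kernel\<close>

text \<open>The slicing error is the error of an empirical mean of i.i.d. variables with expectation
  \<open>K x y\<close>, almost surely bounded by \<open>c\<close> unless both points are the
  origin.\<close>

lemma slicing_error_bounds: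
  fixes k :: "real \<Rightarrow> real \<Rightarrow> real" and K :: "'a::euclidean_space \<Rightarrow> 'a \<Rightarrow> real" and t :: real
  assumes dim: "DIM('a) \<ge> 2"
    and meas: "(\<lambda>(z1, z2). k z1 z2) \<in> borel_measurable borel"
    and K: "K x y = (\<integral>\<zeta>. k (proj \<zeta> x) (proj \<zeta> y) \<partial>uniform_sphere)"
    and c: "c > 0"
    and bound: "\<And>z1 z2. \<bar>z1\<bar> < max (norm x) (norm y) \<Longrightarrow> \<bar>z2\<bar> < max (norm x) (norm y) \<Longrightarrow>
                  \<bar>k z1 z2\<bar> < c"
    and P: "P \<ge> 1"
    and iid: "iid_uniform_sphere M P \<xi>"
  shows slicing_error_tail:
      "t > 0 \<Longrightarrow> measure M {\<omega> \<in> space M. slicing_error k K P (\<lambda>p. \<xi> p \<omega>) x y > t}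
         \<le> 2 * exp (- (real P * t\<^sup>2 / (2 * c\<^sup>2)))"
    and slicing_error_expectation:
      "(\<integral>\<omega>. slicing_error k K P (\<lambda>p. \<xi> p \<omega>) x y \<partial>M) \<le> c / sqrt (real P)"
proof -
  interpret prob_space M
    using iid by (simp add: iid_uniform_sphere_def)
  interpret U: prob_space "uniform_sphere :: 'a measure"
    by (rule prob_space_uniform_sphere)
  have goal: "(t > 0 \<longrightarrow> prob {\<omega> \<in> space M. slicing_error k K P (\<lambda>p. \<xi> p \<omega>) x y > t}
         \<le> 2 * exp (- (real P * t\<^sup>2 / (2 * c\<^sup>2)))) \<and>
       expectation (\<lambda>\<omega>. slicing_error k K P (\<lambda>p. \<xi> p \<omega>) x y) \<le> c / sqrt (real P)" for t
  \<comment> \<open>At the origin the open square in \<open>bound\<close> is empty, so no bound on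
    \<open>k 0 0\<close> is available; but there every summand and \<open>K x y\<close> equal
    \<open>k 0 0\<close>, and the error is 0.\<close>
  proof (cases "x = 0 \<and> y = 0")
    case True
    have "K x y = (\<integral>\<zeta>. k 0 0 \<partial>(uniform_sphere :: 'a measure))"
      unfolding K by (simp add: proj_def True)
    also have "\<dots> = k 0 0"
      by (simp add: U.prob_space[simplified])
    finally have "K x y = k 0 0" .
    hence "slicing_error k K P (\<lambda>p. \<xi> p \<omega>) x y = 0" for \<omega>
      using True P by (simp add: slicing_error_def proj_def)
    thus ?thesis
      using c by simp
  next
    case False
    define f where "f = (\<lambda>\<zeta>. k (proj \<zeta> x) (proj \<zeta> y))"
    have f [measurable]: "f \<in> borel_measurable borel"
    proof -
      have "(\<lambda>\<zeta>. (proj \<zeta> x, proj \<zeta> y)) \<in> borel \<rightarrow>\<^sub>M borel"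
        unfolding proj_def by measurable
      from measurable_compose[OF this meas] show ?thesis
        by (simp add: f_def)
    qed
    have indep: "indep_vars (\<lambda>_. borel) (\<lambda>p \<omega>. f (\<xi> p \<omega>)) {1..P}"
      by (rule indep_vars_compose2[of "\<lambda>_. borel" \<xi>])
        (use iid in \<open>auto simp: iid_uniform_sphere_def\<close>)
    have rv: "\<xi> p \<in> borel_measurable M" and law: "distr M borel (\<xi> p) = uniform_sphere"
      if "p \<in> {1..P}" for p
      using iid that by (auto simp: iid_uniform_sphere_def indep_vars_def)
    have "x \<noteq> 0 \<or> y \<noteq> 0"
      using False by blast
    from AE_uniform_sphere_proj_less_max[OF dim this]
    have "AE \<zeta> in uniform_sphere. \<bar>f \<zeta>\<bar> \<le> c"
      by (rule eventually_mono) (use bound in \<open>auto simp: f_def intro: less_imp_le\<close>)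
    \<comment> \<open>The bound holds almost everywhere on the sphere and is pulled back along
      \<open>\<xi> p\<close>, whose law is \<open>uniform_sphere\<close>.\<close>
    hence bd: "AE \<omega> in M. \<bar>f (\<xi> p \<omega>)\<bar> \<le> c" if "p \<in> {1..P}" for p
      unfolding law[OF that, symmetric] using rv[OF that] by (subst (asm) AE_distr_iff) auto
    have mean: "expectation (\<lambda>\<omega>. f (\<xi> p \<omega>)) = K x y" if "p \<in> {1..P}" for p
      using integral_distr[OF rv[OF that] f] by (simp add: law[OF that] K f_def)
    have err: "slicing_error k K P (\<lambda>p. \<xi> p \<omega>) x y
        = \<bar>(1 / card {1..P}) * (\<Sum>p\<in>{1..P}. f (\<xi> p \<omega>)) - K x y\<bar>" for \<omega>
      by (simp add: slicing_error_def f_def)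
    note bounds = empirical_mean_error[OF _ _ c indep bd mean]
    show ?thesis
      unfolding err using bounds P by simp
  qed
  show "t > 0 \<Longrightarrow> measure M {\<omega> \<in> space M. slicing_error k K P (\<lambda>p. \<xi> p \<omega>) x y > t}
      \<le> 2 * exp (- (real P * t\<^sup>2 / (2 * c\<^sup>2)))"
    and "(\<integral>\<omega>. slicing_error k K P (\<lambda>p. \<xi> p \<omega>) x y \<partial>M) \<le> c / sqrt (real P)"
    using goal by blast+
qed

text \<open>The O-statement is expressed by one constant \<open>C\<close> for fixed \<open>k\<close>
  and \<open>K\<close>, uniform in the points, the bound \<open>b\<close>, the sample size and the
  probability space on \<open>'w\<close>.\<close>

theorem proposition2p7:
  fixes k :: "real \<Rightarrow> real \<Rightarrow> real"
    and K :: "real^'n \<Rightarrow> real^'n \<Rightarrow> real"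
    and x y :: "real^'n"
    and c :: real
    and P :: nat
    and M :: "'w measure"
    and \<xi> :: "nat \<Rightarrow> 'w \<Rightarrow> real^'n"
  assumes "CARD('n) \<ge> 2"
    and "(\<lambda>(z1, z2). k z1 z2) \<in> borel_measurable borel"
    and "\<And>u v :: real^'n. integrable uniform_sphere (\<lambda>\<zeta>. k (proj \<zeta> u) (proj \<zeta> v))"
    and "\<And>u v :: real^'n. K u v = (\<integral>\<zeta>. k (proj \<zeta> u) (proj \<zeta> v) \<partial>uniform_sphere)"
    and "c > 0"
    and "\<And>z1 z2. \<bar>z1\<bar> < max (norm x) (norm y) \<Longrightarrow> \<bar>z2\<bar> < max (norm x) (norm y) \<Longrightarrow> \<bar>k z1 z2\<bar> < c"
    and "P \<ge> 1"
    and "iid_uniform_sphere M P \<xi>"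
  shows "(\<forall>t>0. measure M {\<omega> \<in> space M. slicing_error k K P (\<lambda>p. \<xi> p \<omega>) x y > t}
                  \<le> 2 * exp (- (real P * t^2 / (2 * c^2))))
       \<and> (\<integral>\<omega>. slicing_error k K P (\<lambda>p. \<xi> p \<omega>) x y \<partial>M) \<le> sqrt (2 * pi) * c / sqrt (real P)
       \<and> (\<exists>C>0. \<forall>u v b Q (N :: 'w measure) \<zeta>.
            b > 0 \<longrightarrow>
            (\<forall>z1 z2. \<bar>z1\<bar> < max (norm u) (norm v) \<longrightarrow> \<bar>z2\<bar> < max (norm u) (norm v) \<longrightarrow> \<bar>k z1 z2\<bar> < b) \<longrightarrow>
            Q \<ge> 1 \<longrightarrow>
            iid_uniform_sphere N Q \<zeta> \<longrightarrow>
            (\<integral>\<omega>. slicing_error k K Q (\<lambda>q. \<zeta> q \<omega>) u v \<partial>N) \<le> C * (b / sqrt (real Q)))"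
proof -
  have dim: "DIM(real^'n) \<ge> 2"
    using assms(1) by simp
  \<comment> \<open>This weakens the sharper mean bound c / sqrt P to the stated constant.\<close>
  have one_le: "1 \<le> sqrt (2 * pi)"
    using pi_gt3 by simp
  \<comment> \<open>Stated for arbitrary points, bounds and samples, this yields both the mean
    estimate at \<open>x\<close>, \<open>y\<close> and the uniform constant
    \<open>C = sqrt (2 * pi)\<close>.\<close>
  have exp_le: "(\<integral>\<omega>. slicing_error k K Q (\<lambda>q. \<zeta> q \<omega>) u v \<partial>N) \<le> sqrt (2 * pi) * (b / sqrt Q)"
    if "b > 0" "\<forall>z1 z2. \<bar>z1\<bar> < max (norm u) (norm v) \<longrightarrow> \<bar>z2\<bar> < max (norm u) (norm v) \<longrightarrow> \<bar>k z1 z2\<bar> < b"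
      "Q \<ge> 1" "iid_uniform_sphere N Q \<zeta>" for u v b Q and N :: "'w measure" and \<zeta>
  proof -
    have "(\<integral>\<omega>. slicing_error k K Q (\<lambda>q. \<zeta> q \<omega>) u v \<partial>N) \<le> b / sqrt Q"
      by (rule slicing_error_expectation[where k = k and K = K and x = u and y = v,
            OF dim assms(2) assms(4) that(1) _ that(3,4)])
        (use that(2) in blast)
    also have "\<dots> \<le> sqrt (2 * pi) * (b / sqrt Q)"
      using mult_right_mono[OF one_le, of "b / sqrt Q"] that(1) by simp
    finally show ?thesis .
  qed
  have "\<exists>C>0. \<forall>u v b Q (N :: 'w measure) \<zeta>.
            b > 0 \<longrightarrow>
            (\<forall>z1 z2. \<bar>z1\<bar> < max (norm u) (norm v) \<longrightarrow> \<bar>z2\<bar> < max (norm u) (norm v) \<longrightarrow> \<bar>k z1 z2\<bar> < b) \<longrightarrow>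
            Q \<ge> 1 \<longrightarrow>
            iid_uniform_sphere N Q \<zeta> \<longrightarrow>
            (\<integral>\<omega>. slicing_error k K Q (\<lambda>q. \<zeta> q \<omega>) u v \<partial>N) \<le> C * (b / sqrt (real Q))"
    by (intro exI[of _ "sqrt (2 * pi)"] conjI allI impI exp_le) (auto simp: pi_gt_zero)
  moreover have "(\<integral>\<omega>. slicing_error k K P (\<lambda>p. \<xi> p \<omega>) x y \<partial>M) \<le> sqrt (2 * pi) * c / sqrt (real P)"
    using exp_le[of c x y P M \<xi>] assms(5-8) by simp
  moreover have "\<forall>t>0. measure M {\<omega> \<in> space M. slicing_error k K P (\<lambda>p. \<xi> p \<omega>) x y > t}
                  \<le> 2 * exp (- (real P * t^2 / (2 * c^2)))"
    by (intro allI impI slicing_error_tail[where k = k and K = K and x = x and y = y,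
          OF dim assms(2) assms(4) assms(5) _ assms(7,8)] assms(6))
  ultimately show ?thesis by blast
qed

end
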